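(* Let $m\ge 1$, $T\subseteq\{0,\ldots,m-1\}$, $\Delta_t=m-t$ for $t\in T$, and let $U=\sum_{t\in T}N^{\Delta_t}$ as a linear operator on $\mathbb{F}_2^m$. If $U=0$, set $r=0$; then $(I+U)^{-1}=I$, with the empty product understood as $I$. Otherwise, put $\Delta_{\min}=\min\{\Delta_t:t\in T\}$ and $$r=\left\lceil\log_2\frac{m}{\Delta_{\min}}\right\rceil.$$ Then $U^{2^r}=0$ and $$(I+U)^{-1}=\prod_{k=0}^{r-1}\bigl(I+U^{2^k}\bigr).$$ Moreover, $r$ is the least nonnegative integer for which $U^{2^r}=0$.
   Context: For $d\ge 0$, $N^d$ is the truncated right shift on $\mathbb{F}_2^m$: for $y=(y_0,\ldots,y_{m-1})$, $(N^dy)_i=y_{i+d}$ if $0\le i<m-d$ and $(N^dy)_i=0$ if $m-d\le i<m$; $N^d=0$ for $d\ge m$. Empty sums denote the zero map and $I$ is the identity on $\mathbb{F}_2^m$. *)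

theory Defs
  imports Complex_Main "HOL-Library.Z2" "Jordan_Normal_Form.Matrix"
begin

text \<open>
  The space F_2^m is \<open>carrier_vec m\<close> over the field \<open>bit\<close>. An operator on it is a function on
  \<open>bit vec\<close>, of which only the values on \<open>carrier_vec m\<close> are meaningful; accordingly, operators
  are compared on \<open>carrier_vec m\<close> only.
\<close>

type_synonym vop = "bit vec \<Rightarrow> bit vec"

definition op_eq :: "nat \<Rightarrow> vop \<Rightarrow> vop \<Rightarrow> bool" where
  "op_eq m A B \<longleftrightarrow> (\<forall>y \<in> carrier_vec m. A y = B y)"

definition zero_op :: "nat \<Rightarrow> vop" where
  "zero_op m = (\<lambda>y. 0\<^sub>v m)"

definition add_op :: "vop \<Rightarrow> vop \<Rightarrow> vop" where
  "add_op A B = (\<lambda>y. A y + B y)"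

definition sum_op :: "nat \<Rightarrow> ('i \<Rightarrow> vop) \<Rightarrow> 'i set \<Rightarrow> vop" where
  "sum_op m A S = (\<lambda>y. finsum_vec TYPE(bit) m (\<lambda>t. A t y) S)"

text \<open>The product \<open>A 0 \<circ> A 1 \<circ> \<dots> \<circ> A (r - 1)\<close>; it is the identity for \<open>r = 0\<close>.\<close>

definition prod_op :: "(nat \<Rightarrow> vop) \<Rightarrow> nat \<Rightarrow> vop" where
  "prod_op A r = foldr (\<circ>) (map A [0..<r]) id"

text \<open>The operator \<open>N^d\<close> on F_2^m; for \<open>d \<ge> m\<close> the difference \<open>m - d\<close> truncates to 0, giving the
  zero map.\<close>

definition shift_op :: "nat \<Rightarrow> nat \<Rightarrow> vop" where
  "shift_op m d = (\<lambda>y. vec m (\<lambda>i. if i < m - d then y $ (i + d) else 0))"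

definition U_op :: "nat \<Rightarrow> nat set \<Rightarrow> vop" where
  "U_op m T = sum_op m (\<lambda>t. shift_op m (m - t)) T"

definition Delta_min :: "nat \<Rightarrow> nat set \<Rightarrow> nat" where
  "Delta_min m T = Min ((\<lambda>t. m - t) ` T)"

text \<open>If \<open>U \<noteq> 0\<close>, then \<open>T\<close> is nonempty and \<open>m / \<Delta>\<^sub>m\<^sub>i\<^sub>n \<ge> 1\<close>, so neither \<open>Min\<close> nor the conversion
  \<open>nat\<close> is applied outside its proper domain.\<close>

definition r_exp :: "nat \<Rightarrow> nat set \<Rightarrow> nat" where
  "r_exp m T = (if op_eq m (U_op m T) (zero_op m) then 0
                else nat \<lceil>log 2 (real m / real (Delta_min m T))\<rceil>)"

definition invertible_op :: "nat \<Rightarrow> vop \<Rightarrow> bool" where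
  "invertible_op m A \<longleftrightarrow> bij_betw A (carrier_vec m) (carrier_vec m)"

definition inv_op :: "nat \<Rightarrow> vop \<Rightarrow> vop" where
  "inv_op m A = inv_into (carrier_vec m) A"

text \<open>The notation \<open>N^d\<close> is consistent: these maps are the iterates of \<open>N\<close>.\<close>

lemma shift_op_funpow: "op_eq m (shift_op m 1 ^^ d) (shift_op m d)"
proof (induction d)
  case 0
  show ?case by (auto simp: op_eq_def shift_op_def)
next
  case (Suc d)
  show ?case unfolding op_eq_def
  proof
    fix y :: "bit vec" assume "y \<in> carrier_vec m"
    then have "(shift_op m 1 ^^ Suc d) y = shift_op m 1 (shift_op m d y)"
      using Suc by (simp add: op_eq_def)
    also have "\<dots> = shift_op m (Suc d) y"
      by (rule eq_vecI) (auto simp: shift_op_def)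
    finally show "(shift_op m 1 ^^ Suc d) y = shift_op m (Suc d) y" .
  qed
qed

lemma U_op_closed: "finite T \<Longrightarrow> U_op m T y \<in> carrier_vec m"
  unfolding U_op_def sum_op_def by (rule finsum_vec_closed) (auto simp: shift_op_def)

lemma U_op_index:
  assumes "finite T" "i < m"
  shows "U_op m T y $ i = (\<Sum>t\<in>T. shift_op m (m - t) y $ i)"
  unfolding U_op_def sum_op_def
  by (rule index_finsum_vec[OF assms]) (auto simp: shift_op_def)

lemma U_op_linear:
  assumes T: "finite T" and x: "x \<in> carrier_vec m" and y: "y \<in> carrier_vec m"
  shows "U_op m T (x + y) = U_op m T x + U_op m T y"
    and "U_op m T (c \<cdot>\<^sub>v x) = c \<cdot>\<^sub>v U_op m T x"
proof -
  have dim: "dim_vec (U_op m T z) = m" for z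
    using U_op_closed[OF T] by (rule carrier_vecD)
  show "U_op m T (x + y) = U_op m T x + U_op m T y"
  proof (rule eq_vecI)
    fix i assume "i < dim_vec (U_op m T x + U_op m T y)"
    then have i: "i < m" by (simp add: dim)
    have "shift_op m d (x + y) $ i = shift_op m d x $ i + shift_op m d y $ i" for d
      using i x y unfolding shift_op_def by simp
    then show "U_op m T (x + y) $ i = (U_op m T x + U_op m T y) $ i"
      by (simp only: i dim index_add_vec U_op_index[OF T i] sum.distrib)
  qed (simp add: dim)
  show "U_op m T (c \<cdot>\<^sub>v x) = c \<cdot>\<^sub>v U_op m T x"
  proof (rule eq_vecI)
    fix i assume "i < dim_vec (c \<cdot>\<^sub>v U_op m T x)"
    then have i: "i < m" by (simp add: dim)
    have "shift_op m d (c \<cdot>\<^sub>v x) $ i = c * shift_op m d x $ i" for d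
      using i x unfolding shift_op_def by simp
    then show "U_op m T (c \<cdot>\<^sub>v x) $ i = (c \<cdot>\<^sub>v U_op m T x) $ i"
      by (simp only: i dim index_smult_vec U_op_index[OF T i] sum_distrib_left)
  qed (simp add: dim)
qed

end

theory Submission
  imports Defs
begin

text \<open>
  Let \<open>T\<close> be nonempty and \<open>\<delta> = Delta_min m T\<close>. One application of \<open>U\<close> moves the last nonzero position of a vector
  down by exactly \<open>\<delta>\<close>, since the shift by \<open>\<delta>\<close> occurs exactly once in \<open>U\<close> and all other shifts are
  longer. Hence \<open>U ^^ k = 0\<close> iff \<open>m \<le> k * \<delta>\<close>, which identifies \<open>r\<close> as the least exponent.
  In characteristic 2 the square of \<open>I + V\<close> is \<open>I + V\<^sup>2\<close>, so \<open>I + U\<close> times the product telescopes to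
  \<open>I + U ^^ (2 ^ r) = I\<close>.
\<close>

lemma bit_vec_add_left_cancel:
  "x \<in> carrier_vec m \<Longrightarrow> y \<in> carrier_vec m \<Longrightarrow> x + (x + y) = (y :: bit vec)"
  by (rule eq_vecI) (auto simp flip: add.assoc)

text \<open>Pulling the seed out of the fold serves \<open>prod_op_Suc\<close>: over an appended
  list, \<open>foldr\<close> leaves the last factor in the seed.\<close>

lemma foldr_comp_init: "foldr (\<circ>) fs g = foldr (\<circ>) fs id \<circ> g"
  by (induction fs) (auto simp: comp_assoc)

lemma prod_op_0: "prod_op A 0 = id"
  by (simp add: prod_op_def)

lemma prod_op_Suc: "prod_op A (Suc r) = prod_op A r \<circ> A r"
  unfolding prod_op_def by (simp, subst foldr_comp_init) simp

lemma funpow_closed: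
  assumes "\<And>y. y \<in> C \<Longrightarrow> f y \<in> C" and "y \<in> C"
  shows "(f ^^ n) y \<in> C"
  using assms by (induction n) auto

lemma funpow_additive:
  fixes U :: vop
  assumes "\<And>y. y \<in> carrier_vec m \<Longrightarrow> U y \<in> carrier_vec m"
    and "\<And>x y. x \<in> carrier_vec m \<Longrightarrow> y \<in> carrier_vec m \<Longrightarrow> U (x + y) = U x + U y"
    and "x \<in> carrier_vec m" and "y \<in> carrier_vec m"
  shows "(U ^^ n) (x + y) = (U ^^ n) x + (U ^^ n) y"
proof (induction n)
  case (Suc n)
  then show ?case
    using assms(2)[OF funpow_closed[where f = U, OF assms(1,3)]
        funpow_closed[where f = U, OF assms(1,4)]] by simp
qed simp

section \<open>Telescoping product for an additive operator\<close>

context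
  fixes m :: nat and U :: vop
  assumes closed: "\<And>y. y \<in> carrier_vec m \<Longrightarrow> U y \<in> carrier_vec m"
    and additive: "\<And>x y. x \<in> carrier_vec m \<Longrightarrow> y \<in> carrier_vec m \<Longrightarrow> U (x + y) = U x + U y"
begin

lemma pow_closed: "y \<in> carrier_vec m \<Longrightarrow> (U ^^ k) y \<in> carrier_vec m"
  by (intro funpow_closed[of "carrier_vec m" U] closed)

lemma add_op_pow_closed: "y \<in> carrier_vec m \<Longrightarrow> add_op id (U ^^ k) y \<in> carrier_vec m"
  by (simp add: add_op_def pow_closed)

text \<open>Both cross terms equal \<open>(U ^^ k) y\<close>, so they cancel in characteristic
  2.\<close>

lemma add_op_pow_square:
  assumes y: "y \<in> carrier_vec m"
  shows "add_op id (U ^^ k) (add_op id (U ^^ k) y) = add_op id (U ^^ (2 * k)) y"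
proof -
  note c = pow_closed
  have "add_op id (U ^^ k) (add_op id (U ^^ k) y)
      = (y + (U ^^ k) y) + ((U ^^ k) y + (U ^^ (k + k)) y)"
    using y c by (simp add: add_op_def funpow_additive[where U = U, OF closed additive] funpow_add)
  also have "\<dots> = y + (U ^^ (k + k)) y"
    using y c[OF y] by (simp add: bit_vec_add_left_cancel[of _ m] assoc_add_vec[of _ m])
  finally show ?thesis
    by (simp add: add_op_def mult_2)
qed

text \<open>Both factors are polynomials in \<open>U\<close>. The left telescoping uses this to move
  \<open>I + U\<close> past the factor that \<open>prod_op_Suc\<close> splits off.\<close>

lemma add_op_pow_commute:
  assumes y: "y \<in> carrier_vec m"
  shows "add_op id (U ^^ j) (add_op id (U ^^ k) y) = add_op id (U ^^ k) (add_op id (U ^^ j) y)"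
proof -
  note c = pow_closed
  have "(U ^^ j) ((U ^^ k) y) = (U ^^ k) ((U ^^ j) y)"
    by (metis add.commute comp_apply funpow_add)
  moreover have "a + b + (c + d) = a + c + (b + d)"
    if "a \<in> carrier_vec m" "b \<in> carrier_vec m" "c \<in> carrier_vec m" "d \<in> carrier_vec m"
    for a b c d :: "bit vec"
    using that by (intro eq_vecI) (auto simp: algebra_simps)
  ultimately show ?thesis
    using y c by (simp add: add_op_def funpow_additive[where U = U, OF closed additive])
qed

abbreviation (input) pow_prod where "pow_prod \<equiv> prod_op (\<lambda>k. add_op id (U ^^ (2 ^ k)))"

lemma prod_op_pow_closed: "y \<in> carrier_vec m \<Longrightarrow> pow_prod r y \<in> carrier_vec m"
  by (induction r arbitrary: y) (simp_all add: prod_op_0 prod_op_Suc add_op_pow_closed)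

lemma prod_op_telescope_right:
  "y \<in> carrier_vec m \<Longrightarrow> add_op id U (pow_prod r y) = add_op id (U ^^ (2 ^ r)) y"
proof (induction r arbitrary: y)
  case (Suc r)
  \<comment> \<open>The factor split off acts first, so the induction hypothesis is applied to its
    image of \<open>y\<close>.\<close>
  have "add_op id U (pow_prod (Suc r) y) = add_op id (U ^^ (2 ^ r)) (add_op id (U ^^ (2 ^ r)) y)"
    unfolding prod_op_Suc comp_apply by (intro Suc.IH add_op_pow_closed Suc.prems)
  also have "\<dots> = add_op id (U ^^ (2 ^ Suc r)) y"
    unfolding power_Suc by (rule add_op_pow_square[OF Suc.prems])
  finally show ?case .
qed (simp add: prod_op_0)

lemma prod_op_telescope_left:
  "y \<in> carrier_vec m \<Longrightarrow> pow_prod r (add_op id U y) = add_op id (U ^^ (2 ^ r)) y"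
proof (induction r arbitrary: y)
  case (Suc r)
  have "pow_prod (Suc r) (add_op id U y) = pow_prod r (add_op id U (add_op id (U ^^ (2 ^ r)) y))"
    using add_op_pow_commute[OF Suc.prems, of "2 ^ r" 1] by (simp add: prod_op_Suc)
  also have "\<dots> = add_op id (U ^^ (2 ^ r)) (add_op id (U ^^ (2 ^ r)) y)"
    by (intro Suc.IH add_op_pow_closed Suc.prems)
  also have "\<dots> = add_op id (U ^^ (2 ^ Suc r)) y"
    unfolding power_Suc by (rule add_op_pow_square[OF Suc.prems])
  finally show ?case .
qed (simp add: prod_op_0)

text \<open>Both telescoped products become the identity: the left one yields injectivity, the right
  one surjectivity and the values of the inverse.\<close>

lemma inverse_of_nilpotent:
  assumes "op_eq m (U ^^ (2 ^ r)) (zero_op m)"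
  shows "invertible_op m (add_op id U)" and "op_eq m (inv_op m (add_op id U)) (pow_prod r)"
proof -
  have id: "add_op id (U ^^ (2 ^ r)) y = y" if "y \<in> carrier_vec m" for y
    using assms that by (simp add: op_eq_def add_op_def zero_op_def)
  have A_closed: "add_op id U y \<in> carrier_vec m" if "y \<in> carrier_vec m" for y
    using add_op_pow_closed[OF that, of 1] by simp
  show inv: "invertible_op m (add_op id U)"
    unfolding invertible_op_def
    by (rule bij_betw_byWitness[where f' = "pow_prod r"])
      (auto simp: prod_op_telescope_left prod_op_telescope_right id A_closed prod_op_pow_closed)
  show "op_eq m (inv_op m (add_op id U)) (pow_prod r)"
    using inv unfolding op_eq_def inv_op_def invertible_op_def bij_betw_def
    by (auto intro!: inv_into_f_eq simp: prod_op_telescope_right id prod_op_pow_closed)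
qed

end

section \<open>Nilpotency of U and its smallest shift\<close>

context
  fixes m :: nat and T :: "nat set" and \<delta> :: nat
  assumes m: "m \<ge> 1" and T: "T \<subseteq> {0..m - 1}" "T \<noteq> {}" and \<delta>: "\<delta> = Delta_min m T"
begin

lemma Delta_min_props:
  shows "finite T" and "t \<in> T \<Longrightarrow> \<delta> \<le> m - t" and "m - \<delta> \<in> T" and "1 \<le> \<delta>" and "\<delta> \<le> m"
proof -
  show fin: "finite T" using T finite_subset by blast
  then show "t \<in> T \<Longrightarrow> \<delta> \<le> m - t" unfolding \<delta> Delta_min_def by simp
  have "\<delta> \<in> (\<lambda>t. m - t) ` T" unfolding \<delta> Delta_min_def using fin T by (intro Min_in) auto
  then obtain t where t: "t \<in> T" "\<delta> = m - t" by auto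
  \<comment> \<open>As \<open>m \<ge> 1\<close>, this makes the truncated \<open>m - t\<close> exact
    and positive, so \<open>t\<close> is recovered as \<open>m - \<delta>\<close>.\<close>
  moreover have "t \<le> m - 1" using t T by auto
  ultimately have "m - \<delta> = t" "1 \<le> \<delta>" "\<delta> \<le> m" using m by auto
  with t show "m - \<delta> \<in> T" "1 \<le> \<delta>" "\<delta> \<le> m" by auto
qed

text \<open>Each summand at \<open>i\<close> is either 0 by truncation or an entry of
  \<open>y\<close> at a position at least \<open>i + \<delta>\<close>.\<close>

lemma U_op_vanishes_above:
  assumes y: "\<And>i. i < m \<Longrightarrow> j \<le> i \<Longrightarrow> y $ i = 0" and i: "i < m" "j \<le> i + \<delta>"
  shows "U_op m T y $ i = 0"
  unfolding U_op_index[OF Delta_min_props(1) i(1)]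
proof (rule sum.neutral, intro ballI)
  fix t assume "t \<in> T"
  then show "shift_op m (m - t) y $ i = 0"
    using Delta_min_props(2)[of t] i y by (auto simp: shift_op_def)
qed

lemma U_op_leading_entry:
  assumes y: "\<And>i. i < m \<Longrightarrow> i > i' + \<delta> \<Longrightarrow> y $ i = 0" and i': "i' + \<delta> < m"
  shows "U_op m T y $ i' = y $ (i' + \<delta>)"
proof -
  have i: "i' < m" using i' by simp
  have z: "shift_op m (m - t) y $ i' = 0" if "t \<in> T - {m - \<delta>}" for t
  proof -
    have "t \<le> m - 1" using that T by auto
    \<comment> \<open>Strict, because \<open>m - t = \<delta>\<close> would make \<open>t\<close>
      the excluded index \<open>m - \<delta>\<close>.\<close>
    then have "\<delta> < m - t" using that Delta_min_props(2)[of t] Delta_min_props(5) m by auto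
    then show ?thesis using i y by (auto simp: shift_op_def)
  qed
  have "U_op m T y $ i' = shift_op m (m - (m - \<delta>)) y $ i'"
    unfolding U_op_index[OF Delta_min_props(1) i]
    by (subst sum.remove[OF Delta_min_props(1,3)]) (simp add: z)
  then show ?thesis using i' Delta_min_props(5) by (simp add: shift_op_def)
qed

lemma U_op_pow_vanishes:
  "i < m \<Longrightarrow> j \<le> i + k * \<delta> \<Longrightarrow> (\<And>i. i < m \<Longrightarrow> j \<le> i \<Longrightarrow> y $ i = 0)
    \<Longrightarrow> (U_op m T ^^ k) y $ i = 0"
proof (induction k arbitrary: i)
  case (Suc k)
  \<comment> \<open>By induction \<open>(U_op m T ^^ k) y\<close> vanishes from
    \<open>j - k * \<delta>\<close> on. Truncation is harmless:
    \<open>j - k * \<delta> \<le> i\<close> still means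
    \<open>j \<le> i + k * \<delta>\<close>.\<close>
  have "U_op m T ((U_op m T ^^ k) y) $ i = 0"
    using Suc by (intro U_op_vanishes_above[where j = "j - k * \<delta>"]) auto
  then show ?case by simp
qed simp

text \<open>The last unit vector starts at the highest position, so its leading 1 survives as long
  as \<open>k * \<delta> < m\<close> and witnesses a nonzero power.\<close>

lemma U_op_pow_unit_vec:
  "k * \<delta> < m \<Longrightarrow> (U_op m T ^^ k) (unit_vec m (m - 1)) $ (m - 1 - k * \<delta>) = 1"
proof (induction k)
  case (Suc k)
  let ?y = "(U_op m T ^^ k) (unit_vec m (m - 1))" and ?i = "m - 1 - Suc k * \<delta>"
  have i: "?i + \<delta> = m - 1 - k * \<delta>" using Suc.prems by simp
  have "U_op m T ?y $ ?i = ?y $ (?i + \<delta>)"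
  proof (rule U_op_leading_entry)
    show "?y $ i = 0" if "i < m" "?i + \<delta> < i" for i
    \<comment> \<open>The bound \<open>j = m\<close> holds for every vector, the unit vector
      included.\<close>
    proof (rule U_op_pow_vanishes[where j = m, OF that(1)])
      show "m \<le> i + k * \<delta>" using that(2) unfolding i by linarith
    qed simp
    show "?i + \<delta> < m" unfolding i using m by linarith
  qed
  also have "\<dots> = 1" unfolding i using Suc.prems by (intro Suc.IH) simp
  finally show ?case by simp
qed (use m in simp)

lemma U_op_pow_zero_iff: "op_eq m (U_op m T ^^ k) (zero_op m) \<longleftrightarrow> m \<le> k * \<delta>"
proof
  assume "op_eq m (U_op m T ^^ k) (zero_op m)"
  then have "(U_op m T ^^ k) (unit_vec m (m - 1)) = 0\<^sub>v m"
    by (simp add: op_eq_def zero_op_def)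
  then show "m \<le> k * \<delta>" using U_op_pow_unit_vec[of k] m by (cases "k * \<delta> < m") auto
next
  assume k: "m \<le> k * \<delta>"
  show "op_eq m (U_op m T ^^ k) (zero_op m)" unfolding op_eq_def zero_op_def
  proof (intro ballI eq_vecI)
    fix y :: "bit vec" assume y: "y \<in> carrier_vec m"
    have "(U_op m T ^^ k) y \<in> carrier_vec m"
      using U_op_closed[OF Delta_min_props(1)] y by (rule funpow_closed)
    then show "dim_vec ((U_op m T ^^ k) y) = dim_vec (0\<^sub>v m :: bit vec)" by simp
    fix i assume "i < dim_vec (0\<^sub>v m :: bit vec)"
    then show "(U_op m T ^^ k) y $ i = 0\<^sub>v m $ i"
      using k U_op_pow_vanishes[of i m k y] by simp
  qed
qed

text \<open>Comparing with an arbitrary \<open>s\<close> removes ceiling and logarithm by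
  monotonicity and matches \<open>U_op_pow_zero_iff\<close> at \<open>k = 2 ^ s\<close>.\<close>

lemma r_exp_le_iff: "r_exp m T \<le> s \<longleftrightarrow> m \<le> 2 ^ s * \<delta>"
proof (cases "op_eq m (U_op m T) (zero_op m)")
  case True
  \<comment> \<open>With \<open>T\<close> nonempty, \<open>U = 0\<close> forces
    \<open>\<delta> = m\<close>, that is \<open>T = {0}\<close>; both sides then hold for every
    \<open>s\<close>.\<close>
  then have "m \<le> \<delta>" using U_op_pow_zero_iff[of 1] by simp
  also have "\<delta> \<le> 2 ^ s * \<delta>" by simp
  finally show ?thesis using True by (simp add: r_exp_def)
next
  case False
  have pos: "0 < real m / real \<delta>" "0 < real \<delta>" using m Delta_min_props(4) by auto
  have "r_exp m T \<le> s \<longleftrightarrow> log 2 (real m / real \<delta>) \<le> real s"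
    using False by (simp add: r_exp_def \<delta> nat_le_iff ceiling_le_iff)
  also have "\<dots> \<longleftrightarrow> real m / real \<delta> \<le> 2 ^ s"
    using pos by (subst log_le_iff) (auto simp: powr_realpow)
  also have "\<dots> \<longleftrightarrow> real m \<le> real (2 ^ s * \<delta>)"
    using pos by (simp add: divide_le_eq)
  finally show ?thesis by (simp only: of_nat_le_iff)
qed

end

text \<open>The equivalence contains both vanishing (at \<open>s = r\<close>) and minimality. For
  empty \<open>T\<close> there is no minimum; there \<open>U\<close> is zero, and
  \<open>2 ^ s > 0\<close> keeps its power from being the identity.\<close>

lemma U_op_pow_2_zero_iff:
  assumes "m \<ge> 1" and "T \<subseteq> {0..m - 1}"
  shows "op_eq m (U_op m T ^^ (2 ^ s)) (zero_op m) \<longleftrightarrow> r_exp m T \<le> s"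
proof (cases "T = {}")
  case True
  then have U: "U_op m T = zero_op m"
    by (simp add: U_op_def sum_op_def zero_op_def finsum_vec_empty)
  have "(zero_op m ^^ k) y = 0\<^sub>v m" if "k > 0" for k y
    using that by (cases k) (auto simp: zero_op_def)
  then show ?thesis by (auto simp: U op_eq_def r_exp_def zero_op_def)
next
  case False
  then show ?thesis
    using U_op_pow_zero_iff[OF assms False refl] r_exp_le_iff[OF assms False refl] by simp
qed

theorem theorem3p3:
  fixes m :: nat and T :: "nat set" and U :: vop and r :: nat
  assumes "m \<ge> 1" and "T \<subseteq> {0..m - 1}"
    and "U = U_op m T" and "r = r_exp m T"
  shows "invertible_op m (add_op id U) \<and>
    (op_eq m U (zero_op m) \<longrightarrow> op_eq m (inv_op m (add_op id U)) id) \<and>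
    op_eq m (U ^^ (2 ^ r)) (zero_op m) \<and>
    op_eq m (inv_op m (add_op id U)) (prod_op (\<lambda>k. add_op id (U ^^ (2 ^ k))) r) \<and>
    (\<forall>s. op_eq m (U ^^ (2 ^ s)) (zero_op m) \<longrightarrow> r \<le> s)"
proof -
  have T: "finite T" using assms(2) finite_subset by blast
  have zero_iff: "op_eq m (U ^^ (2 ^ s)) (zero_op m) \<longleftrightarrow> r \<le> s" for s
    using U_op_pow_2_zero_iff[OF assms(1,2)] assms(3,4) by simp
  have inverse: "invertible_op m (add_op id U)"
    "op_eq m (inv_op m (add_op id U)) (prod_op (\<lambda>k. add_op id (U ^^ (2 ^ k))) r)"
    using inverse_of_nilpotent[where U = U and r = r and m = m]
      U_op_closed[OF T] U_op_linear(1)[OF T] zero_iff[of r] assms(3) by auto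
  \<comment> \<open>At \<open>s = 0\<close> the power is \<open>U\<close> itself; with
    \<open>r = 0\<close> the product is empty, hence \<open>id\<close>.\<close>
  moreover have "r = 0" if "op_eq m U (zero_op m)"
    using that zero_iff[of 0] by simp
  ultimately show ?thesis
    using zero_iff by (auto simp: prod_op_0)
qed

end
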